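(* Let $n\in\mathbb{N}$ and let $\mathfrak A\subset\mathbb{R}^n$ be a compact convex $n$-dimensional set with center of mass $A$. Let $\Lambda$ be the dilation with factor $\lambda>0$ about a homothetic center $O\in\mathfrak A$ such that $O\neq A$, and, for $\lambda\ne 1$, let $B=B(\lambda)$ be the center of mass of the set $\mathfrak B$ defined in the context. Then the following holds. (i) If $\lambda>1$, then for $p\in\mathbb{R}_+$: $\lambda=\lambda^{(n)}(p)$ if and only if $d(A,B)/d(O,A)=p$, where (in this case) $p>\frac1n$; i.e., then $\lambda^{(n)}(p)=d(O,\Lambda(A))/d(O,A)$. (ii) If $0<\lambda<1$, then for $p\in\mathbb{R}_+$: $\lambda=1/\lambda^{(n)}(p)$ if and only if $d(\Lambda(A),B)/d(O,\Lambda(A))=p$, where (in this case) $p>\frac1n$; i.e., then $\lambda^{(n)}(p)=d(O,A)/d(O,\Lambda(A))$. (iii) If $\lambda=1$, then $\lambda=\lambda^{(n)}\left(\frac1n\right)$ if and only if $d(A,B(1))=d(\Lambda(A),B(1))=\frac1n\,d(O,A)$.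
   Context: $\mathbb{R}_+=(0,\infty)$, $\mathbb{N}=\{1,2,\dots\}$, and $d(\cdot,\cdot)$ is the Euclidean distance in $\mathbb{R}^n$. For $p\in\mathbb{R}_+$ and $n\in\mathbb{N}$, $\lambda^{(n)}(p)$ denotes the dominant root of the polynomial $P^{(n)}_p(\lambda)=\lambda^n-p(\lambda^{n-1}+\cdots+\lambda+1)$, i.e. its unique positive root. The dilation with factor $\lambda$ about $O$ is $\Lambda(X)=O+\lambda(X-O)$. "Center of mass" means the centroid with respect to $n$-dimensional Lebesgue measure; "$n$-dimensional" means having nonempty interior. $\Lambda(A)$ is the center of mass of $\Lambda(\mathfrak A)$. Since $O\in\mathfrak A$, $\mathfrak A\subsetneq\Lambda(\mathfrak A)$ if $\lambda>1$ and $\Lambda(\mathfrak A)\subsetneq\mathfrak A$ if $0<\lambda<1$; define $\mathfrak B=\Lambda(\mathfrak A)\setminus\mathfrak A$ if $\lambda>1$ and $\mathfrak B=\mathfrak A\setminus\Lambda(\mathfrak A)$ if $0<\lambda<1$, and let $B(\lambda)$ be the center of mass of $\mathfrak B$. For $\lambda=1$ one sets $B(1)=\lim_{1\ne\lambda\to1}B(\lambda)$ (with $\mathfrak A$ and $O$ fixed); this limit exists. *)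

theory Defs
  imports "HOL-Analysis.Analysis" "HOL-Computational_Algebra.Polynomial"
begin

definition P_poly :: "nat \<Rightarrow> real \<Rightarrow> real poly" where
  "P_poly n p = monom 1 n - smult p (\<Sum>k<n. monom 1 k)"

text \<open>The definite description is justified for \<open>n \<ge> 1\<close> and \<open>p > 0\<close> by \<open>P_poly_ex1_pos_root\<close>
  below; \<open>dom_root_dominant\<close> shows that this root strictly dominates all other complex roots.\<close>

definition dom_root :: "nat \<Rightarrow> real \<Rightarrow> real" where
  "dom_root n p = (THE x. x > 0 \<and> poly (P_poly n p) x = 0)"

definition dilation :: "'a::real_vector \<Rightarrow> real \<Rightarrow> 'a \<Rightarrow> 'a" where
  "dilation O' l X = O' + l *\<^sub>R (X - O')"

text \<open>Meaningful only for sets of finite positive Lebesgue measure on which the identity is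
  integrable.\<close>

definition center_of_mass :: "'a::euclidean_space set \<Rightarrow> 'a" where
  "center_of_mass S = (1 / measure lebesgue S) *\<^sub>R set_lebesgue_integral lebesgue S (\<lambda>x. x)"

definition diff_set :: "'a::real_vector set \<Rightarrow> 'a \<Rightarrow> real \<Rightarrow> 'a set" where
  "diff_set S O' l = (if l > 1 then dilation O' l ` S - S else S - dilation O' l ` S)"

text \<open>\<open>Lim\<close> is an unspecified point if the limit does not exist, so statements about the value at
  \<open>l = 1\<close> should be accompanied by convergence.\<close>

definition diff_center :: "'a::euclidean_space set \<Rightarrow> 'a \<Rightarrow> real \<Rightarrow> 'a" where
  "diff_center S O' l =
     (if l = 1 then Lim (at 1) (\<lambda>m. center_of_mass (diff_set S O' m))
      else center_of_mass (diff_set S O' l))"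

lemma poly_P_poly: "poly (P_poly n p) x = x ^ n - p * (\<Sum>k<n. x ^ k)"
  by (simp add: P_poly_def poly_monom poly_sum)

lemma poly_P_poly_less:
  assumes "n \<ge> 1" "p > 0" "0 < x" "x < y" "poly (P_poly n p) x \<ge> 0"
  shows "poly (P_poly n p) y > 0"
proof -
  have *: "y ^ k * x ^ n < x ^ k * y ^ n" if "k < n" for k
  proof -
    have "x ^ (n - k) < y ^ (n - k)"
      using that assms by (intro power_strict_mono) auto
    hence "(x ^ k * y ^ k) * x ^ (n - k) < (x ^ k * y ^ k) * y ^ (n - k)"
      using assms by (intro mult_strict_left_mono) auto
    moreover have "x ^ n = x ^ k * x ^ (n - k)" "y ^ n = y ^ k * y ^ (n - k)"
      using that by (simp_all flip: power_add)
    ultimately show ?thesis by (simp add: mult_ac)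
  qed
  have "(\<Sum>k<n. y ^ k * x ^ n) < (\<Sum>k<n. x ^ k * y ^ n)"
    using * assms(1) by (intro sum_strict_mono) (auto simp: lessThan_empty_iff)
  hence "p * (\<Sum>k<n. y ^ k) * x ^ n < p * (\<Sum>k<n. x ^ k) * y ^ n"
    using assms(2) by (simp add: mult.assoc sum_distrib_right)
  also have "\<dots> \<le> x ^ n * y ^ n"
    using assms by (intro mult_right_mono) (auto simp: poly_P_poly)
  finally have "p * (\<Sum>k<n. y ^ k) < y ^ n"
    using assms(3) by (simp add: mult.commute)
  thus ?thesis by (simp add: poly_P_poly)
qed

lemma P_poly_ex1_pos_root:
  assumes "n \<ge> 1" "p > 0"
  shows "\<exists>!x. x > 0 \<and> poly (P_poly n p) x = 0"
proof -
  have "poly (P_poly n p) 0 < 0"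
  proof -
    have "(\<Sum>k<n. (0::real) ^ k) = 1"
      using assms(1) by (simp add: power_0_left sum.delta)
    thus ?thesis using assms by (simp add: poly_P_poly zero_power)
  qed
  moreover have "poly (P_poly n p) (1 + p) > 0"
  proof -
    have "p * (\<Sum>k<n. (1 + p) ^ k) = (1 + p) ^ n - 1"
      using power_diff_1_eq[of "1 + p" n] by simp
    thus ?thesis by (simp add: poly_P_poly)
  qed
  ultimately obtain x where "x > 0" "poly (P_poly n p) x = 0"
    using poly_IVT_pos[of 0 "1 + p" "P_poly n p"] assms(2) by auto
  moreover have "y = x" if "y > 0" "poly (P_poly n p) y = 0" for y
    using poly_P_poly_less[OF assms, of x y] poly_P_poly_less[OF assms, of y x] that calculation
    by (cases x y rule: linorder_cases) auto
  ultimately show ?thesis by blast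
qed

lemma dom_root:
  assumes "n \<ge> 1" "p > 0"
  shows "dom_root n p > 0" "poly (P_poly n p) (dom_root n p) = 0"
  using theI'[OF P_poly_ex1_pos_root[OF assms]] by (simp_all add: dom_root_def)

lemma dom_root_dominant:
  fixes z :: complex
  assumes "n \<ge> 1" "p > 0" and root: "z ^ n - of_real p * (\<Sum>k<n. z ^ k) = 0"
    and ne: "z \<noteq> of_real (dom_root n p)"
  shows "norm z < dom_root n p"
proof (rule ccontr)
  define r where "r = norm z"
  assume "\<not> norm z < dom_root n p"
  hence r: "dom_root n p \<le> r" by (simp add: r_def)
  have le: "r ^ n = p * norm (\<Sum>k<n. z ^ k)"
    using root assms(2) by (simp add: r_def norm_mult flip: norm_power)
  also have "\<dots> \<le> p * (\<Sum>k<n. r ^ k)"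
    using assms(2) norm_sum[of "\<lambda>k. z ^ k" "{..<n}"] by (simp add: r_def norm_power)
  finally have "\<not> poly (P_poly n p) r > 0" by (simp add: poly_P_poly)
  hence req: "r = dom_root n p"
    using poly_P_poly_less[OF assms(1,2) dom_root(1)[OF assms(1,2)], of r]
      dom_root(2)[OF assms(1,2)] r by force
  hence "r ^ n = p * (\<Sum>k<n. r ^ k)"
    using dom_root(2)[OF assms(1,2)] by (simp add: poly_P_poly)
  hence eq: "norm (\<Sum>k<n. z ^ k) = (\<Sum>k<n. r ^ k)"
    using le assms(2) by simp
  have "z = of_real r"
  proof (cases "n = 1")
    case True
    hence "z = of_real p" using root by simp
    thus ?thesis using assms(2) by (simp add: r_def)
  next
    case False
    hence m: "n = Suc (Suc (n - 2))"
      using assms(1) by simp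
    define m where "m = n - 2"
    note m = m [folded m_def]
    have split: "(\<Sum>k<n. f k) = (f 0 + f 1) + (\<Sum>k<m. f (Suc (Suc k)))"
      for f :: "nat \<Rightarrow> 'b::ab_group_add"
      by (subst m) (simp only: sum.lessThan_Suc_shift add.assoc One_nat_def)
    have "norm (\<Sum>k<n. z ^ k) \<le> norm (1 + z) + norm (\<Sum>k<m. z ^ Suc (Suc k))"
      using norm_triangle_ineq[of "1 + z"] by (simp add: split)
    also have "norm (\<Sum>k<m. z ^ Suc (Suc k)) \<le> (\<Sum>k<m. r ^ Suc (Suc k))"
      using norm_sum[of "\<lambda>k. z ^ Suc (Suc k)" "{..<m}"]
      by (simp only: norm_power r_def)
    finally have "1 + r \<le> norm (1 + z)"
      unfolding eq unfolding split by simp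
    hence "norm (1 + z) = norm (1::complex) + norm z"
      using norm_triangle_ineq[of 1 z] by (simp add: r_def)
    hence "norm (1::complex) *\<^sub>R z = norm z *\<^sub>R 1"
      by (simp only: norm_triangle_eq)
    thus ?thesis by (simp add: r_def scaleR_conv_of_real)
  qed
  thus False using ne req by simp
qed

end

theory Submission
  imports Defs
begin

text \<open>
  Writing \<open>V\<close> for the volume of \<open>S\<close>, the dilated set has volume \<open>l ^ n * V\<close> and center of mass
  \<open>\<Lambda> A\<close>. Balancing first moments of the nested sets \<open>S\<close> and \<open>\<Lambda> S\<close> gives, on both sides of
  \<open>l = 1\<close>, the single formula \<open>B l - O' = ((l ^ (n+1) - 1) / (l ^ n - 1)) *\<^sub>R (A - O')\<close>.
  All three claims are then elementary facts about this ratio on the ray from \<open>O'\<close> through \<open>A\<close>.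
\<close>

section \<open>Moments of compact sets\<close>

lemma set_integrable_compact_id:
  fixes S :: "'a::euclidean_space set"
  assumes "compact S"
  shows "set_integrable lebesgue S (\<lambda>x. x)"
  \<comment> \<open>\<open>lebesgue\<close> is the completion of \<open>lborel\<close>, so
    integrability of a Borel function carries over.\<close>
  unfolding set_integrable_def
  using borel_integrable_compact[OF assms continuous_on_id]
  by (intro iffD2[OF integrable_completion]) auto

lemma measure_scaleR_center_of_mass:
  assumes "measure lebesgue S \<noteq> 0"
  shows "measure lebesgue S *\<^sub>R center_of_mass S = set_lebesgue_integral lebesgue S (\<lambda>x. x)"
  using assms by (simp add: center_of_mass_def)

lemma measure_pos_interior:
  fixes S :: "'a::euclidean_space set"
  assumes "compact S" "interior S \<noteq> {}"
  shows "measure lebesgue S > 0"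
proof -
  have "\<not> negligible S"
    using assms(2) by (meson interior_subset negligible_subset open_interior open_not_negligible)
  thus ?thesis
    using lmeasurable_compact[OF assms(1)] measure_nonneg[of lebesgue S]
    by (metis negligible_iff_measure order_le_less)
qed

text \<open>First moments add over the disjoint pieces \<open>S - T\<close> and \<open>T\<close>.
  The strict bounds on the measures make all three masses nonzero, so mass times center recovers
  each moment.\<close>

lemma center_of_mass_Diff:
  fixes S T :: "'a::euclidean_space set"
  assumes "compact S" "compact T" "T \<subseteq> S"
    and "0 < measure lebesgue T" "measure lebesgue T < measure lebesgue S"
  shows "(measure lebesgue S - measure lebesgue T) *\<^sub>R center_of_mass (S - T) =
    measure lebesgue S *\<^sub>R center_of_mass S - measure lebesgue T *\<^sub>R center_of_mass T"
proof -
  have lm: "S \<in> lmeasurable" "T \<in> lmeasurable" "S - T \<in> lmeasurable"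
    using assms by (auto intro: lmeasurable_compact fmeasurable_Diff)
  have m: "measure lebesgue (S - T) = measure lebesgue S - measure lebesgue T"
    using lm assms(3) by (intro measurable_measure_Diff) auto
  have "set_integrable lebesgue (S - T) (\<lambda>x. x)"
    using lm by (intro set_integrable_subset[OF set_integrable_compact_id[OF assms(1)]]) auto
  hence "set_lebesgue_integral lebesgue ((S - T) \<union> T) (\<lambda>x. x) =
      set_lebesgue_integral lebesgue (S - T) (\<lambda>x. x) + set_lebesgue_integral lebesgue T (\<lambda>x. x)"
    using set_integrable_compact_id[OF assms(2)] by (intro set_integral_Un) auto
  moreover have "(S - T) \<union> T = S"
    using assms(3) by auto
  ultimately show ?thesis
    using assms(4,5) measure_scaleR_center_of_mass[of S] measure_scaleR_center_of_mass[of T]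
      measure_scaleR_center_of_mass[of "S - T"] m
    by simp
qed

section \<open>Dilations\<close>

lemma dilation_image_compact: "compact S \<Longrightarrow> compact (dilation c l ` S)"
  for S :: "'a::real_normed_vector set"
  unfolding dilation_def by (intro compact_continuous_image continuous_intros)

lemma dilation_image_subset:
  assumes "convex S" "c \<in> S" "0 \<le> l" "l \<le> 1"
  shows "dilation c l ` S \<subseteq> S"
proof
  fix y assume "y \<in> dilation c l ` S"
  \<comment> \<open>The image point is a convex combination of \<open>c\<close> and \<open>x\<close>
    with weights \<open>1 - l\<close> and \<open>l\<close>.\<close>
  then obtain x where "x \<in> S" "y = (1 - l) *\<^sub>R c + l *\<^sub>R x"
    by (auto simp: dilation_def algebra_simps)
  thus "y \<in> S"
    using assms by (auto intro: convexD)
qed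

text \<open>The inverse dilation has factor \<open>1 / l\<close>, at most 1, and so maps
  \<open>S\<close> into itself.\<close>

lemma subset_dilation_image:
  assumes "convex S" "c \<in> S" "1 \<le> l"
  shows "S \<subseteq> dilation c l ` S"
proof
  fix x assume "x \<in> S"
  hence "dilation c (1 / l) x \<in> S"
    using dilation_image_subset[OF assms(1,2), of "1 / l"] assms(3) by auto
  moreover have "x = dilation c l (dilation c (1 / l) x)"
    using assms(3) by (simp add: dilation_def)
  ultimately show "x \<in> dilation c l ` S" by blast
qed

lemma measure_dilation_image:
  fixes S :: "'a::euclidean_space set"
  assumes "l > 0"
  shows "measure lebesgue (dilation c l ` S) = l ^ DIM('a) * measure lebesgue S"
proof -
  have "dilation c l = (\<lambda>x. l *\<^sub>R x + (c - l *\<^sub>R c))"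
    by (auto simp: dilation_def algebra_simps)
  thus ?thesis
    using measure_lebesgue_affine[of l "c - l *\<^sub>R c" S] assms by simp
qed

text \<open>Change of variables: the first moment picks up the Jacobian \<open>l ^ DIM('a)\<close>,
  the same factor as the measure, so it cancels in the quotient.\<close>

lemma center_of_mass_dilation_image:
  fixes S :: "'a::euclidean_space set"
  assumes "compact S" "measure lebesgue S > 0" "l > 0"
  shows "center_of_mass (dilation c l ` S) = dilation c l (center_of_mass S)"
proof -
  \<comment> \<open>This brings the dilation into the form required by
    \<open>lborel_affine\<close>.\<close>
  define d where "d = c - l *\<^sub>R c"
  define T where "T = (\<lambda>x. d + l *\<^sub>R x)"
  have T: "dilation c l = T"
    by (auto simp: dilation_def T_def d_def algebra_simps)
  define f where "f = (\<lambda>x. indicator (T ` S) x *\<^sub>R x)"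
  have S: "S \<in> lmeasurable" using assms(1) by (rule lmeasurable_compact)
  have cT: "compact (T ` S)"
    using dilation_image_compact[OF assms(1), of c l] by (simp add: T)
  have f: "integrable lborel f"
    unfolding f_def using borel_integrable_compact[OF cT continuous_on_id] by simp
  have fm: "f \<in> borel_measurable borel"
    using borel_measurable_integrable[OF f] by simp
  have fT: "f (T x) = indicator S x *\<^sub>R T x" for x
    using assms(3) by (auto simp: f_def T_def indicator_def)
  have fTm: "(\<lambda>x. f (T x)) \<in> borel_measurable borel"
    using fm unfolding T_def by measurable
  have c: "set_lebesgue_integral lebesgue S (\<lambda>_. d) = measure lebesgue S *\<^sub>R d"
    using fmeasurableD[OF S] fmeasurableD2[OF S] by (intro set_integral_const) auto
  have "set_lebesgue_integral lebesgue (T ` S) (\<lambda>x. x) = integral\<^sup>L lborel f"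
    using fm by (simp add: set_lebesgue_integral_def f_def integral_completion)
  also have "\<dots> = integral\<^sup>L (density (distr lborel borel T) (\<lambda>_. ennreal (l ^ DIM('a)))) f"
    using lborel_affine[of l d] assms(3) by (simp add: T_def ennreal_power)
  also have "\<dots> = l ^ DIM('a) *\<^sub>R integral\<^sup>L lborel (\<lambda>x. f (T x))"
    using fm assms(3) by (subst integral_density) (auto simp: integral_distr T_def)
  also have "integral\<^sup>L lborel (\<lambda>x. f (T x)) = set_lebesgue_integral lebesgue S T"
    using fTm by (simp add: integral_completion set_lebesgue_integral_def fT)
  also have "set_lebesgue_integral lebesgue S T =
      measure lebesgue S *\<^sub>R d + l *\<^sub>R set_lebesgue_integral lebesgue S (\<lambda>x. x)"
    unfolding T_def using S c set_integrable_compact_id[OF assms(1)]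
    by (subst set_integral_add(2))
      (auto simp: absolutely_integrable_on_const)
  also have "\<dots> = measure lebesgue S *\<^sub>R T (center_of_mass S)"
    using assms(2)
    by (simp add: T_def scaleR_add_right mult.commute flip: measure_scaleR_center_of_mass)
  finally have "set_lebesgue_integral lebesgue (T ` S) (\<lambda>x. x) =
      measure lebesgue (T ` S) *\<^sub>R T (center_of_mass S)"
    using measure_dilation_image[OF assms(3), of c S] by (simp add: T)
  moreover have "measure lebesgue (T ` S) > 0"
    using measure_dilation_image[OF assms(3), of c S] assms(2,3) by (simp add: T)
  ultimately show ?thesis
    by (simp add: T center_of_mass_def[of "T ` S"])
qed

section \<open>Center of mass of the difference set\<close>

lemma diff_center_eq:
  fixes S :: "'a::euclidean_space set"
  assumes "compact S" "convex S" "interior S \<noteq> {}" "c \<in> S" "l > 0" "l \<noteq> 1"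
  shows "diff_center S c l = dilation c ((l ^ (DIM('a) + 1) - 1) / (l ^ DIM('a) - 1)) (center_of_mass S)"
proof -
  define q where "q = l ^ DIM('a)"
  define V where "V = measure lebesgue S"
  define T where "T = dilation c l ` S"
  define A where "A = center_of_mass S"
  have V: "V > 0" unfolding V_def using assms by (intro measure_pos_interior)
  have q: "q > 0" using assms by (simp add: q_def)
  have mT: "measure lebesgue T = q * V"
    using assms by (simp add: T_def q_def V_def measure_dilation_image)
  have aT: "center_of_mass T = dilation c l A"
    using assms V unfolding T_def V_def A_def by (intro center_of_mass_dilation_image)
  have cT: "compact T" unfolding T_def using assms by (intro dilation_image_compact)
  have ne: "q \<noteq> 1"
    using assms power_eq_iff_eq_base[of "DIM('a)" l 1] by (simp add: q_def)
  \<comment> \<open>For \<open>l < 1\<close> the roles of \<open>S\<close> and \<open>T\<close>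
    swap, which negates both sides of the moment balance. With the signed mass
    \<open>(q - 1) * V\<close> the same equation covers both cases.\<close>
  have "((q - 1) * V) *\<^sub>R diff_center S c l = (q * V) *\<^sub>R dilation c l A - V *\<^sub>R A"
  proof (cases "l > 1")
    case True
    hence "q > 1" by (simp add: q_def one_less_power)
    moreover have "S \<subseteq> T"
      unfolding T_def using assms True by (intro subset_dilation_image) auto
    ultimately show ?thesis
      using center_of_mass_Diff[OF cT assms(1)] V True mT aT
      by (simp add: diff_center_def diff_set_def T_def V_def A_def left_diff_distrib)
  next
    case False
    hence "q < 1" using assms by (simp add: q_def power_less_one_iff)
    moreover have "T \<subseteq> S"
      unfolding T_def using assms False by (intro dilation_image_subset) auto
    ultimately have "(V - q * V) *\<^sub>R diff_center S c l = V *\<^sub>R A - (q * V) *\<^sub>R dilation c l A"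
      using center_of_mass_Diff[OF assms(1) cT] V q False mT aT assms(6)
      by (simp add: diff_center_def diff_set_def T_def V_def A_def)
    thus ?thesis by (simp add: algebra_simps)
  qed
  also have "\<dots> = ((q - 1) * V) *\<^sub>R dilation c ((l * q - 1) / (q - 1)) A"
  proof -
    \<comment> \<open>Both sides are expanded as combinations of \<open>c\<close> and
      \<open>A\<close>, and the coefficients compared; \<open>l * q\<close> is
      \<open>l ^ (DIM('a) + 1)\<close>.\<close>
    have "dilation c ((l * q - 1) / (q - 1)) A =
        (1 - (l * q - 1) / (q - 1)) *\<^sub>R c + ((l * q - 1) / (q - 1)) *\<^sub>R A"
      by (simp add: dilation_def algebra_simps)
    moreover have "((q - 1) * V) * (1 - (l * q - 1) / (q - 1)) = q * V - q * V * l"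
      "((q - 1) * V) * ((l * q - 1) / (q - 1)) = q * V * l - V"
      using ne by (simp_all add: field_simps)
    ultimately have "((q - 1) * V) *\<^sub>R dilation c ((l * q - 1) / (q - 1)) A =
        (q * V - q * V * l) *\<^sub>R c + (q * V * l - V) *\<^sub>R A"
      by (simp only: scaleR_add_right scaleR_scaleR)
    thus ?thesis by (simp add: dilation_def algebra_simps)
  qed
  finally show ?thesis
    using ne V by (simp add: q_def A_def)
qed

text \<open>All points of the theorem are dilates of \<open>A\<close> about \<open>O'\<close>, so
  every distance reduces to a difference of factors.\<close>

lemma dist_dilation_dilation: "dist (dilation c a x) (dilation c b x) = \<bar>a - b\<bar> * dist c x"
  for x :: "'a::real_normed_vector"
  by (simp add: dilation_def dist_norm norm_minus_commute flip: scaleR_left_diff_distrib)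

lemma dist_dilation_center: "dist c (dilation c a x) = \<bar>a\<bar> * dist c x"
  for x :: "'a::real_normed_vector"
  using dist_dilation_dilation[of c 0 x a] by (simp add: dilation_def)

section \<open>The dominant root\<close>

text \<open>The root equation is linear in \<open>p\<close> with a positive coefficient sum, so it
  can be solved for \<open>p\<close>; uniqueness of the positive root does the rest.\<close>

lemma dom_root_eq_iff:
  assumes "n \<ge> 1" "p > 0" "x > 0"
  shows "x = dom_root n p \<longleftrightarrow> p = x ^ n / (\<Sum>k<n. x ^ k)"
proof -
  have "(\<Sum>k<n. x ^ k) > 0"
    using assms by (intro sum_pos) (auto simp: lessThan_empty_iff)
  hence "poly (P_poly n p) x = 0 \<longleftrightarrow> p = x ^ n / (\<Sum>k<n. x ^ k)"
    by (auto simp: poly_P_poly field_simps)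
  moreover have "x = dom_root n p \<longleftrightarrow> poly (P_poly n p) x = 0"
    using P_poly_ex1_pos_root[OF assms(1,2)] dom_root[OF assms(1,2)] assms(3) by blast
  ultimately show ?thesis by simp
qed

text \<open>For a root \<open>x > 1\<close> each of the \<open>n\<close> powers in the sum is below
  \<open>x ^ n\<close>, hence \<open>x ^ n < p * n * x ^ n\<close>.\<close>

lemma dom_root_gt_1_imp:
  assumes "n \<ge> 1" "p > 0" "dom_root n p > 1"
  shows "p > 1 / n"
proof -
  define x where "x = dom_root n p"
  have x: "x > 1" using assms by (simp add: x_def)
  have "(\<Sum>k<n. x ^ k) < (\<Sum>k<n. x ^ n)"
    using x assms(1) by (intro sum_strict_mono) (auto simp: lessThan_empty_iff power_strict_increasing)
  hence "p * (\<Sum>k<n. x ^ k) < p * (n * x ^ n)"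
    using assms(2) by simp
  moreover have "x ^ n = p * (\<Sum>k<n. x ^ k)"
    using dom_root(2)[OF assms(1,2)] by (simp add: poly_P_poly x_def)
  ultimately have "x ^ n * 1 < x ^ n * (p * n)"
    by (simp add: mult_ac)
  moreover have "x ^ n > 0" using x by simp
  ultimately have "1 < p * n"
    by (simp only: mult_less_cancel_left_pos)
  thus ?thesis using assms(1) by (simp add: field_simps)
qed

text \<open>The ratio is the factor of the center \<open>B\<close>. The first form measures it from
  \<open>A\<close> (factor 1), for the case \<open>l > 1\<close>; the second from
  \<open>\<Lambda> A\<close> (factor \<open>x\<close>), for \<open>l < 1\<close>.\<close>

lemma power_ratio_eq:
  fixes x :: real
  assumes "n \<ge> 1" "x > 0" "x \<noteq> 1"
  shows "(x ^ (n + 1) - 1) / (x ^ n - 1) = 1 + x ^ n / (\<Sum>k<n. x ^ k)"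
    and "(x ^ (n + 1) - 1) / (x ^ n - 1) = x + 1 / (\<Sum>k<n. x ^ k)"
proof -
  define s where "s = (\<Sum>k<n. x ^ k)"
  have s: "s > 0" unfolding s_def
    using assms by (intro sum_pos) (auto simp: lessThan_empty_iff)
  \<comment> \<open>The geometric sum exposes the common factor \<open>x - 1\<close>, whose
    cancellation removes the singularity at 1.\<close>
  have xn: "x ^ n = (x - 1) * s + 1"
    using power_diff_1_eq[of x n] by (simp add: s_def)
  have "(x ^ (n + 1) - 1) / (x ^ n - 1) = ((x - 1) * (x * s + 1)) / ((x - 1) * s)"
    by (simp add: xn algebra_simps)
  also have "\<dots> = (x * s + 1) / s"
    using assms(3) by simp
  finally have *: "(x ^ (n + 1) - 1) / (x ^ n - 1) = (x * s + 1) / s" .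
  show "(x ^ (n + 1) - 1) / (x ^ n - 1) = x + 1 / (\<Sum>k<n. x ^ k)"
    using s unfolding * by (fold s_def) (simp add: field_simps)
  show "(x ^ (n + 1) - 1) / (x ^ n - 1) = 1 + x ^ n / (\<Sum>k<n. x ^ k)"
    using s unfolding * by (fold s_def) (simp add: field_simps xn)
qed

text \<open>Reversing the order of summation turns powers of \<open>1 / x\<close> into powers of
  \<open>x\<close>. This lets the case \<open>l < 1\<close> use the root criterion at
  \<open>1 / l\<close>.\<close>

lemma inverse_power_ratio:
  fixes x :: real
  assumes "n \<ge> 1" "x > 0"
  shows "(1 / x) ^ n / (\<Sum>k<n. (1 / x) ^ k) = 1 / (x * (\<Sum>k<n. x ^ k))"
proof -
  \<comment> \<open>With \<open>Suc k\<close> the exponents run down from \<open>n - 1\<close> to 0,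
    as \<open>sum.nat_diff_reindex\<close> expects; the extra factor \<open>1 / x\<close> is split
    off afterwards.\<close>
  have "x ^ n * (1 / x) ^ Suc k = x ^ (n - Suc k)" if "k < n" for k
    using that assms(2) by (simp add: power_diff power_one_over field_simps)
  hence "x ^ n * (\<Sum>k<n. (1 / x) ^ Suc k) = (\<Sum>k<n. x ^ (n - Suc k))"
    by (simp only: sum_distrib_left) (intro sum.cong, auto)
  also have "\<dots> = (\<Sum>k<n. x ^ k)"
    by (rule sum.nat_diff_reindex)
  also have "(\<Sum>k<n. (1 / x) ^ Suc k) = (\<Sum>k<n. (1 / x) ^ k) / x"
    by (simp add: sum_divide_distrib)
  finally have "x ^ n * (\<Sum>k<n. (1 / x) ^ k) = x * (\<Sum>k<n. x ^ k)"
    using assms(2) by (simp only: times_divide_eq_right divide_eq_eq mult.commute split: if_splits)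
  thus ?thesis
    using assms(2) by (simp add: power_one_over field_simps)
qed

section \<open>The three cases of the dilation factor\<close>

theorem proposition3p1:
  fixes S :: "(real ^ 'n) set" and O' :: "real ^ 'n" and l :: real
  defines "n \<equiv> CARD('n)"
    and "A \<equiv> center_of_mass S"
    and "\<Lambda> \<equiv> dilation O' l"
    and "B \<equiv> diff_center S O'"
  assumes "compact S" and "convex S" and "interior S \<noteq> {}"
    and "l > 0" and "O' \<in> S" and "O' \<noteq> A"
  shows
    "(l > 1 \<longrightarrow> (\<forall>p>0.
        (l = dom_root n p \<longleftrightarrow> dist A (B l) / dist O' A = p) \<and>
        (l = dom_root n p \<longrightarrow> p > 1 / n \<and> dom_root n p = dist O' (\<Lambda> A) / dist O' A))) \<and>
     (l < 1 \<longrightarrow> (\<forall>p>0.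
        (l = 1 / dom_root n p \<longleftrightarrow> dist (\<Lambda> A) (B l) / dist O' (\<Lambda> A) = p) \<and>
        (l = 1 / dom_root n p \<longrightarrow> p > 1 / n \<and> dom_root n p = dist O' A / dist O' (\<Lambda> A)))) \<and>
     (l = 1 \<longrightarrow>
        (B \<longlongrightarrow> B 1) (at 1) \<and>
        (l = dom_root n (1 / n) \<longleftrightarrow>
           dist A (B 1) = dist (\<Lambda> A) (B 1) \<and> dist (\<Lambda> A) (B 1) = 1 / n * dist O' A))"
proof -
  have n: "n \<ge> 1" by (simp add: n_def Suc_leI)
  define s where "s = (\<lambda>x::real. \<Sum>k<n. x ^ k)"
  have s: "s x > 0" if "x > 0" for x
    unfolding s_def using n that by (intro sum_pos) (auto simp: lessThan_empty_iff)
  have D: "dist O' A > 0" using assms(10) by simp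
  \<comment> \<open>Viewing \<open>A\<close> as its own dilate with factor 1 makes
    \<open>dist_dilation_dilation\<close> applicable.\<close>
  have A: "A = dilation O' 1 A" by (simp add: dilation_def)
  have B: "B x = dilation O' (1 + x ^ n / s x) A" "B x = dilation O' (x + 1 / s x) A"
    if "x > 0" "x \<noteq> 1" for x
    using diff_center_eq[OF assms(5-7,9) that] power_ratio_eq[OF n that]
    by (simp_all add: B_def A_def n_def s_def)
  have \<Lambda>: "dist O' (\<Lambda> A) = l * dist O' A"
    using \<open>l > 0\<close> by (simp add: \<Lambda>_def dist_dilation_center)
  have "(l = dom_root n p \<longleftrightarrow> dist A (B l) / dist O' A = p) \<and>
      (l = dom_root n p \<longrightarrow> p > 1 / n \<and> dom_root n p = dist O' (\<Lambda> A) / dist O' A)"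
    if "l > 1" "p > 0" for p
  proof -
    have "dist A (B l) = dist (dilation O' 1 A) (dilation O' (1 + l ^ n / s l) A)"
      using B(1)[of l] that A by simp
    also have "\<dots> = l ^ n / s l * dist O' A"
      using that s[of l] by (simp add: dist_dilation_dilation)
    finally have "dist A (B l) / dist O' A = l ^ n / s l"
      using D by simp
    thus ?thesis
      using dom_root_eq_iff[OF n \<open>p > 0\<close> \<open>l > 0\<close>] dom_root_gt_1_imp[OF n \<open>p > 0\<close>] D \<Lambda> that(1)
      by (auto simp: s_def)
  qed
  moreover have "(l = 1 / dom_root n p \<longleftrightarrow> dist (\<Lambda> A) (B l) / dist O' (\<Lambda> A) = p) \<and>
      (l = 1 / dom_root n p \<longrightarrow> p > 1 / n \<and> dom_root n p = dist O' A / dist O' (\<Lambda> A))"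
    if "l < 1" "p > 0" for p
  proof -
    have "dist (\<Lambda> A) (B l) = 1 / s l * dist O' A"
      using B(2)[of l] that \<open>l > 0\<close> s[of l] by (simp add: \<Lambda>_def dist_dilation_dilation)
    \<comment> \<open>Dividing by \<open>l * dist O' A\<close> leaves \<open>1 / (l * s l)\<close>,
      which is the criterion's quotient at \<open>1 / l\<close>.\<close>
    hence "dist (\<Lambda> A) (B l) / dist O' (\<Lambda> A) = (1 / l) ^ n / s (1 / l)"
      using D \<open>l > 0\<close> \<Lambda> inverse_power_ratio[OF n \<open>l > 0\<close>] by (simp add: s_def)
    moreover have "l = 1 / dom_root n p \<longleftrightarrow> 1 / l = dom_root n p"
      using dom_root(1)[OF n \<open>p > 0\<close>] \<open>l > 0\<close> by (auto simp: field_simps)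
    moreover have "1 / l > 1" using that \<open>l > 0\<close> by simp
    ultimately show ?thesis
      using dom_root_eq_iff[OF n \<open>p > 0\<close>, of "1 / l"] dom_root_gt_1_imp[OF n \<open>p > 0\<close>] D \<Lambda> \<open>l > 0\<close>
      by (auto simp: s_def)
  qed
  moreover have "(B \<longlongrightarrow> B 1) (at 1) \<and>
      (l = dom_root n (1 / n) \<longleftrightarrow>
         dist A (B 1) = dist (\<Lambda> A) (B 1) \<and> dist (\<Lambda> A) (B 1) = 1 / n * dist O' A)"
    if "l = 1"
  proof -
    \<comment> \<open>At 1 the sum \<open>s\<close> has \<open>n\<close> terms equal to 1, so the
      factor \<open>1 + x ^ n / s x\<close> tends to \<open>1 + 1 / n\<close>.\<close>
    define L where "L = dilation O' (1 + 1 / n) A"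
    have "((\<lambda>x. dilation O' (1 + x ^ n / s x) A) \<longlongrightarrow> dilation O' (1 + 1 ^ n / s 1) A) (at 1)"
      unfolding dilation_def s_def using n by (intro tendsto_intros) auto
    hence "((\<lambda>x. dilation O' (1 + x ^ n / s x) A) \<longlongrightarrow> L) (at 1)"
      by (simp add: L_def s_def)
    moreover have "eventually (\<lambda>x::real. x > 0 \<and> x \<noteq> 1) (at 1)"
      using order_tendstoD(1)[OF tendsto_ident_at, of 0 "1::real" UNIV]
      by (auto simp: eventually_at_filter elim: eventually_mono)
    hence "eventually (\<lambda>x. dilation O' (1 + x ^ n / s x) A = B x) (at 1)"
      by eventually_elim (use B(1) in auto)
    ultimately have lim: "(B \<longlongrightarrow> L) (at 1)"
      by (rule Lim_transform_eventually)
    \<comment> \<open>\<open>B 1\<close> is defined by \<open>Lim\<close> of this function, which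
      agrees with \<open>B\<close> away from 1; convergence has to be known before
      \<open>tendsto_Lim\<close> can evaluate it.\<close>
    hence "((\<lambda>x. center_of_mass (diff_set S O' x)) \<longlongrightarrow> L) (at 1)"
      unfolding B_def
      by (rule Lim_transform_eventually) (auto simp: eventually_at_filter diff_center_def)
    hence B1: "B 1 = L"
      by (simp add: B_def diff_center_def tendsto_Lim)
    have "\<Lambda> A = A" using that by (simp add: \<Lambda>_def dilation_def)
    moreover have "dist (dilation O' 1 A) (dilation O' (1 + 1 / n) A) = 1 / n * dist O' A"
      by (simp add: dist_dilation_dilation)
    hence "dist A (B 1) = 1 / n * dist O' A"
      by (simp add: B1 L_def flip: A)
    \<comment> \<open>At \<open>l = 1\<close> both sides of the equivalence are true
      outright.\<close>
    moreover have "l = dom_root n (1 / n)"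
      using dom_root_eq_iff[OF n, of "1 / n" 1] n that by simp
    ultimately show ?thesis using lim B1 by simp
  qed
  ultimately show ?thesis by blast
qed

end
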